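(* Let $\mathcal{M}=\langle X,\mathcal{T},i\rangle$ be a topological model. Then there exists a family $\{\mathcal{F}^\psi\}_{\psi\in\mathcal{L}}$ of finite stable splittings such that: (1) for every formula $\psi$, $\mathcal{F}^\psi\subseteq\mathcal{F}^\circ_{\mathcal{M}}$ and $X\in\mathcal{F}^\psi$; (2) for every formula $\psi$, if $U\in\mathcal{F}^\psi$ then $U^\psi:=\{x\in U : x,U\models\psi\}\in\mathcal{F}_{\mathcal{M}}$; (3) if $\phi$ is a subformula of $\psi$ then $\mathcal{F}^\phi\subseteq\mathcal{F}^\psi$ and $\mathcal{F}^\psi$ is a finite stable splitting for $\phi$.
   Context: Language $\mathcal{L}$: fix a countable set $\mathsf{A}$ of atomic formulas containing $\top,\bot$; formulas are built from atomic formulas by $\land,\neg,\Box,\mathsf{K}$. A topological model is a triple $\langle X,\mathcal{T},i\rangle$ where $\mathcal{T}$ is a topology on $X$ (its members are called opens) and $i:\mathsf{A}\to\mathcal{P}(X)$ with $i(\top)=X$, $i(\bot)=\emptyset$. Satisfaction is defined for pairs $(x,U)$ with $U\in\mathcal{T}$, $x\in U$: $x,U\models A$ iff $x\in i(A)$; Boolean connectives as usual; $x,U\models\mathsf{K}\phi$ iff $y,U\models\phi$ for all $y\in U$; $x,U\models\Box\phi$ iff $x,V\models\phi$ for all $V\in\mathcal{T}$ with $V\subseteq U$ and $x\in V$. For $U\in\mathcal{T}$ let ${\downarrow}U=\{V\in\mathcal{T}: V\subseteq U\}$. For a finite family $\mathcal{F}=\{U_1,\dots,U_n\}$ of opens,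 the remainder of $U_k$ is $\mathrm{Rem}_{\mathcal{F}}(U_k)={\downarrow}U_k-\bigcup_{U_k\not\subseteq U_i}{\downarrow}U_i$. A finite splitting is a finite family of opens closed under (pairwise) intersection; its remainders partition $\bigcup_{U\in\mathcal{F}}{\downarrow}U$. A set $\mathcal{G}$ of opens is stable for $\phi$ if for every $x$, either $x,V\models\phi$ for all $V\in\mathcal{G}$ with $x\in V$, or $x,V\models\neg\phi$ for all $V\in\mathcal{G}$ with $x\in V$. A finite splitting $\mathcal{F}$ is a (finite) stable splitting for $\phi$ if $\mathrm{Rem}_{\mathcal{F}}(U)$ is stable for $\phi$ for every $U\in\mathcal{F}$. $\mathcal{F}_{\mathcal{M}}$ is the least family of subsets of $X$ containing $\{i(A): A\in\mathsf{A}\}$ and closed under complement (relative to $X$), binary intersection and topological interior $S\mapsto S^\circ$; $\mathcal{F}^\circ_{\mathcal{M}}=\{S^\circ : S\in\mathcal{F}_{\mathcal{M}}\}$ $(=\mathcal{F}_{\mathcal{M}}\cap\mathcal{T})$. *)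

theory Defs
  imports "HOL-Analysis.Abstract_Topology"
begin

text \<open>The countable set of atomic formulas is a type of class \<open>countable\<close>; the two
  distinguished atoms are the parameters \<open>tt\<close> and \<open>ff\<close> of \<open>topological_model\<close>.\<close>

datatype 'p form =
    Atom 'p
  | Conj "'p form" "'p form"
  | Neg "'p form"
  | Box "'p form"
  | Know "'p form"

primrec subformulas :: "'p form \<Rightarrow> 'p form set" where
  "subformulas (Atom p) = {Atom p}"
| "subformulas (Conj \<phi> \<psi>) = insert (Conj \<phi> \<psi>) (subformulas \<phi> \<union> subformulas \<psi>)"
| "subformulas (Neg \<phi>) = insert (Neg \<phi>) (subformulas \<phi>)"
| "subformulas (Box \<phi>) = insert (Box \<phi>) (subformulas \<phi>)"
| "subformulas (Know \<phi>) = insert (Know \<phi>) (subformulas \<phi>)"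

definition topological_model ::
    "'p::countable \<Rightarrow> 'p \<Rightarrow> 'a topology \<Rightarrow> ('p \<Rightarrow> 'a set) \<Rightarrow> bool" where
  "topological_model tt ff T i \<longleftrightarrow>
     (\<forall>p. i p \<subseteq> topspace T) \<and> i tt = topspace T \<and> i ff = {}"

text \<open>Satisfaction is meaningful only at pairs with \<open>openin T U\<close> and \<open>x \<in> U\<close>; the clauses
  for \<open>Box\<close> and \<open>Know\<close> lead from such pairs only to such pairs.\<close>

primrec sat :: "'a topology \<Rightarrow> ('p \<Rightarrow> 'a set) \<Rightarrow> 'a \<Rightarrow> 'a set \<Rightarrow> 'p form \<Rightarrow> bool" where
  "sat T i x U (Atom p) \<longleftrightarrow> x \<in> i p"
| "sat T i x U (Conj \<phi> \<psi>) \<longleftrightarrow> sat T i x U \<phi> \<and> sat T i x U \<psi>"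
| "sat T i x U (Neg \<phi>) \<longleftrightarrow> \<not> sat T i x U \<phi>"
| "sat T i x U (Box \<phi>) \<longleftrightarrow> (\<forall>V. openin T V \<and> V \<subseteq> U \<and> x \<in> V \<longrightarrow> sat T i x V \<phi>)"
| "sat T i x U (Know \<phi>) \<longleftrightarrow> (\<forall>y\<in>U. sat T i y U \<phi>)"

definition down :: "'a topology \<Rightarrow> 'a set \<Rightarrow> 'a set set" where
  "down T U = {V. openin T V \<and> V \<subseteq> U}"

definition Rem :: "'a topology \<Rightarrow> 'a set set \<Rightarrow> 'a set \<Rightarrow> 'a set set" where
  "Rem T \<F> U = down T U - (\<Union>W\<in>{W \<in> \<F>. \<not> U \<subseteq> W}. down T W)"

definition finite_splitting :: "'a topology \<Rightarrow> 'a set set \<Rightarrow> bool" where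
  "finite_splitting T \<F> \<longleftrightarrow>
     finite \<F> \<and> (\<forall>U\<in>\<F>. openin T U) \<and> (\<forall>U\<in>\<F>. \<forall>V\<in>\<F>. U \<inter> V \<in> \<F>)"

definition stable :: "'a topology \<Rightarrow> ('p \<Rightarrow> 'a set) \<Rightarrow> 'p form \<Rightarrow> 'a set set \<Rightarrow> bool" where
  "stable T i \<phi> \<G> \<longleftrightarrow>
     (\<forall>x\<in>topspace T. (\<forall>V\<in>\<G>. x \<in> V \<longrightarrow> sat T i x V \<phi>) \<or>
                     (\<forall>V\<in>\<G>. x \<in> V \<longrightarrow> sat T i x V (Neg \<phi>)))"

definition finite_stable_splitting ::
    "'a topology \<Rightarrow> ('p \<Rightarrow> 'a set) \<Rightarrow> 'p form \<Rightarrow> 'a set set \<Rightarrow> bool" where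
  "finite_stable_splitting T i \<phi> \<F> \<longleftrightarrow>
     finite_splitting T \<F> \<and> (\<forall>U\<in>\<F>. stable T i \<phi> (Rem T \<F> U))"

inductive_set generated_family :: "'a topology \<Rightarrow> ('p \<Rightarrow> 'a set) \<Rightarrow> 'a set set"
  for T :: "'a topology" and i :: "'p \<Rightarrow> 'a set" where
  atom: "i p \<in> generated_family T i"
| compl: "S \<in> generated_family T i \<Longrightarrow> topspace T - S \<in> generated_family T i"
| inter: "S \<in> generated_family T i \<Longrightarrow> S' \<in> generated_family T i
    \<Longrightarrow> S \<inter> S' \<in> generated_family T i"
| interior: "S \<in> generated_family T i \<Longrightarrow> T interior_of S \<in> generated_family T i"

definition generated_opens :: "'a topology \<Rightarrow> ('p \<Rightarrow> 'a set) \<Rightarrow> 'a set set" where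
  "generated_opens T i = {T interior_of S | S. S \<in> generated_family T i}"

end

theory Submission
  imports Defs
begin

text \<open>Two opens lie in the same remainder of a finite splitting \<open>F\<close> iff they are contained in
  the same members of \<open>F\<close>; the members containing an open \<open>V\<close> have a least element, the hull of
  \<open>V\<close>. So \<open>F\<close> is stable for \<open>\<phi>\<close> iff truth of \<open>\<phi>\<close> at \<open>(x, V)\<close> depends only on \<open>x\<close> and on the
  members of \<open>F\<close> above \<open>V\<close>, a property that is inherited by larger splittings.

  Let \<open>F\<close> be stable for \<open>\<phi>\<close>. If \<open>W\<close> is the hull of \<open>V\<close>, then \<open>K \<phi>\<close> holds at \<open>V\<close> iff \<open>V\<close> is
  contained in the interior of \<open>{x \<in> W. x, W \<Turnstile> \<phi>}\<close>. And \<open>\<box> \<phi>\<close> holds at \<open>(x, V)\<close> iff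
  \<open>x, W \<Turnstile> \<phi>\<close> for each \<open>W \<in> F\<close> that contains \<open>x\<close> and is the hull of \<open>V \<inter> W\<close>. The latter means
  that \<open>V \<inter> W \<subseteq> W'\<close> only for those \<open>W' \<in> F\<close> above \<open>W\<close>, and \<open>V \<inter> W \<subseteq> W'\<close> says that \<open>V\<close> is
  contained in the interior of \<open>(X - W) \<union> W'\<close>. Adding these finitely many opens and closing
  under intersection gives splittings stable for \<open>K \<phi>\<close> and \<open>\<box> \<phi>\<close>.\<close>

section \<open>Closing a finite family under intersection\<close>

definition inter_closure :: "'a set set \<Rightarrow> 'a set set" where
  "inter_closure \<S> = {\<Inter>\<A> | \<A>. \<A> \<subseteq> \<S> \<and> \<A> \<noteq> {}}"

lemma inter_closure_superset: "\<S> \<subseteq> inter_closure \<S>"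
proof
  fix U assume "U \<in> \<S>"
  then have "U = \<Inter>{U} \<and> {U} \<subseteq> \<S> \<and> {U} \<noteq> {}" by simp
  then show "U \<in> inter_closure \<S>" unfolding inter_closure_def by blast
qed

lemma finite_inter_closure:
  assumes "finite \<S>"
  shows "finite (inter_closure \<S>)"
proof -
  have "inter_closure \<S> \<subseteq> Inter ` Pow \<S>"
    by (auto simp: inter_closure_def)
  then show ?thesis
    using assms by (meson finite_Pow_iff finite_imageI finite_subset)
qed

lemma Int_in_inter_closure:
  assumes "U \<in> inter_closure \<S>" "V \<in> inter_closure \<S>"
  shows "U \<inter> V \<in> inter_closure \<S>"
proof -
  obtain \<A> \<B> where "U = \<Inter>\<A>" "\<A> \<subseteq> \<S>" "\<A> \<noteq> {}" "V = \<Inter>\<B>" "\<B> \<subseteq> \<S>"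
    using assms by (auto simp: inter_closure_def)
  then have "U \<inter> V = \<Inter>(\<A> \<union> \<B>) \<and> \<A> \<union> \<B> \<subseteq> \<S> \<and> \<A> \<union> \<B> \<noteq> {}" by auto
  then show ?thesis unfolding inter_closure_def by blast
qed

lemma Inter_in_if_Int_closed:
  assumes "finite \<A>" "\<A> \<noteq> {}" "\<A> \<subseteq> \<C>" "\<And>U V. U \<in> \<C> \<Longrightarrow> V \<in> \<C> \<Longrightarrow> U \<inter> V \<in> \<C>"
  shows "\<Inter>\<A> \<in> \<C>"
  using assms(1-3) by (induction rule: finite_ne_induct) (auto intro: assms(4))

text \<open>Taking \<open>\<C>\<close> to be the opens or \<open>generated_family T i\<close>
  reduces a claim about the closure to its generators. Binary intersections suffice because
  \<open>\<S>\<close> is finite.\<close>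

lemma inter_closure_least:
  assumes "finite \<S>" "\<S> \<subseteq> \<C>" "\<And>U V. U \<in> \<C> \<Longrightarrow> V \<in> \<C> \<Longrightarrow> U \<inter> V \<in> \<C>"
  shows "inter_closure \<S> \<subseteq> \<C>"
proof
  fix U assume "U \<in> inter_closure \<S>"
  then obtain \<A> where "U = \<Inter>\<A>" "\<A> \<subseteq> \<S>" "\<A> \<noteq> {}"
    by (auto simp: inter_closure_def)
  then show "U \<in> \<C>"
    using Inter_in_if_Int_closed[of \<A> \<C>] assms finite_subset by blast
qed

section \<open>Remainders, hulls and determination of truth values\<close>

definition same_above :: "'a set set \<Rightarrow> 'a set \<Rightarrow> 'a set \<Rightarrow> bool" where
  "same_above \<F> V V' \<longleftrightarrow> (\<forall>W\<in>\<F>. V \<subseteq> W \<longleftrightarrow> V' \<subseteq> W)"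

lemma same_above_sym: "same_above \<F> V V' \<Longrightarrow> same_above \<F> V' V"
  by (auto simp: same_above_def)

lemma same_above_trans:
  "same_above \<F> U V \<Longrightarrow> same_above \<F> V W \<Longrightarrow> same_above \<F> U W"
  by (auto simp: same_above_def)

lemma same_above_antimono: "\<F> \<subseteq> \<G> \<Longrightarrow> same_above \<G> V V' \<Longrightarrow> same_above \<F> V V'"
  by (auto simp: same_above_def)

text \<open>If some \<open>W\<close> in \<open>\<F>\<close> contained \<open>V\<close> but not
  \<open>U\<close>, then \<open>V\<close> would have been removed from the remainder. So every
  \<open>W\<close> above \<open>V\<close> contains \<open>U\<close>, hence
  \<open>V'\<close>.\<close>

lemma same_above_Rem:
  assumes "V \<in> Rem T \<F> U" "V' \<in> Rem T \<F> U"
  shows "same_above \<F> V V'"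
proof -
  have "V' \<subseteq> W" if "V \<subseteq> W" "W \<in> \<F>" "V \<in> Rem T \<F> U" "V' \<in> Rem T \<F> U" for V V' W
  proof -
    have "U \<subseteq> W" using that(1-3) by (auto simp: Rem_def down_def)
    moreover have "V' \<subseteq> U" using that(4) by (simp add: Rem_def down_def)
    ultimately show ?thesis by simp
  qed
  then show ?thesis using assms unfolding same_above_def by metis
qed

lemma openin_Rem: "V \<in> Rem T \<F> U \<Longrightarrow> openin T V"
  by (simp add: Rem_def down_def)

text \<open>Unlike stability, this condition is monotone in \<open>\<F>\<close> for trivial reasons.\<close>

definition determines ::
    "'a topology \<Rightarrow> ('p \<Rightarrow> 'a set) \<Rightarrow> 'a set set \<Rightarrow> 'p form \<Rightarrow> bool" where
  "determines T i \<F> \<phi> \<longleftrightarrow>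
     (\<forall>V V' x. openin T V \<and> openin T V' \<and> same_above \<F> V V' \<and> x \<in> V \<and> x \<in> V' \<longrightarrow>
        sat T i x V \<phi> = sat T i x V' \<phi>)"

lemma determinesD:
  assumes "determines T i \<F> \<phi>" "openin T V" "openin T V'" "same_above \<F> V V'"
    and "x \<in> V" "x \<in> V'"
  shows "sat T i x V \<phi> = sat T i x V' \<phi>"
  using assms unfolding determines_def by simp

lemma determines_mono:
  assumes "determines T i \<F> \<phi>" "\<F> \<subseteq> \<G>"
  shows "determines T i \<G> \<phi>"
  unfolding determines_def
  using determinesD[OF assms(1)] same_above_antimono[OF assms(2)] by simp

lemma finite_stable_splitting_if_determines:
  assumes "finite_splitting T \<F>" "determines T i \<F> \<phi>"
  shows "finite_stable_splitting T i \<phi> \<F>"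
proof -
  have "stable T i \<phi> (Rem T \<F> U)" for U
  proof -
    have "sat T i x V \<phi> = sat T i x V' \<phi>"
      if "V \<in> Rem T \<F> U" "V' \<in> Rem T \<F> U" "x \<in> V" "x \<in> V'" for x V V'
      by (rule determinesD[OF assms(2) openin_Rem[OF that(1)] openin_Rem[OF that(2)]
            same_above_Rem[OF that(1,2)] that(3,4)])
    then show ?thesis unfolding stable_def sat.simps by blast
  qed
  then show ?thesis using assms(1) by (simp add: finite_stable_splitting_def)
qed

text \<open>Because of \<open>topspace T\<close>, the members above \<open>V\<close> form a nonempty
  finite family, so their intersection, the hull, stays in \<open>\<F>\<close>.\<close>

lemma same_above_hullE:
  assumes "finite_splitting T \<F>" "topspace T \<in> \<F>" "openin T V"
  obtains W where "W \<in> \<F>" "openin T W" "V \<subseteq> W" "same_above \<F> V W"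
proof -
  define W where "W = \<Inter>{W \<in> \<F>. V \<subseteq> W}"
  have "topspace T \<in> {W \<in> \<F>. V \<subseteq> W}"
    using assms(2) openin_subset[OF assms(3)] by simp
  moreover have "finite {W \<in> \<F>. V \<subseteq> W}"
    using assms(1) by (simp add: finite_splitting_def)
  ultimately have W: "W \<in> \<F>"
    unfolding W_def using assms(1)
    by (intro Inter_in_if_Int_closed) (auto simp: finite_splitting_def)
  show ?thesis
  proof (rule that[OF W])
    show "openin T W" using W assms(1) by (simp add: finite_splitting_def)
    show "V \<subseteq> W" by (auto simp: W_def)
    then show "same_above \<F> V W"
      unfolding same_above_def by (auto simp: W_def)
  qed
qed

section \<open>Knowledge and box over a finite splitting\<close>

definition open_imp :: "'a topology \<Rightarrow> 'a set \<Rightarrow> 'a set \<Rightarrow> 'a set" where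
  "open_imp T W W' = T interior_of (topspace T - (W - W'))"

text \<open>For open \<open>W\<close> and \<open>W'\<close>, \<open>open_imp\<close> is Heyting
  implication in the lattice of opens, and this is its adjunction with intersection.\<close>

lemma subset_open_imp_iff:
  assumes "openin T V"
  shows "V \<subseteq> open_imp T W W' \<longleftrightarrow> V \<inter> W \<subseteq> W'"
proof -
  have "V \<subseteq> open_imp T W W' \<longleftrightarrow> V \<subseteq> topspace T - (W - W')"
    unfolding open_imp_def by (rule interior_of_maximal_eq[OF assms])
  also have "\<dots> \<longleftrightarrow> V \<inter> W \<subseteq> W'"
    using openin_subset[OF assms] by blast
  finally show ?thesis .
qed

definition truth_set ::
    "'a topology \<Rightarrow> ('p \<Rightarrow> 'a set) \<Rightarrow> 'p form \<Rightarrow> 'a set \<Rightarrow> 'a set" where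
  "truth_set T i \<phi> U = {x \<in> U. sat T i x U \<phi>}"

lemma sat_Know_iff:
  assumes "determines T i \<F> \<phi>" "openin T V" "openin T W" "V \<subseteq> W" "same_above \<F> V W"
  shows "sat T i x V (Know \<phi>) \<longleftrightarrow> V \<subseteq> T interior_of (truth_set T i \<phi> W)"
proof -
  have "sat T i x V (Know \<phi>) \<longleftrightarrow> (\<forall>y\<in>V. sat T i y W \<phi>)"
    using determinesD[OF assms(1-3,5)] assms(4) by auto
  also have "\<dots> \<longleftrightarrow> V \<subseteq> truth_set T i \<phi> W"
    using assms(4) by (auto simp: truth_set_def)
  also have "\<dots> \<longleftrightarrow> V \<subseteq> T interior_of (truth_set T i \<phi> W)"
    by (rule interior_of_maximal_eq[OF assms(2), symmetric])
  finally show ?thesis .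
qed

lemma sat_Box_iff:
  assumes F: "finite_splitting T \<F>" "topspace T \<in> \<F>"
    and det: "determines T i \<F> \<phi>" and V: "openin T V" "x \<in> V"
  shows "sat T i x V (Box \<phi>) \<longleftrightarrow>
    (\<forall>W\<in>\<F>. (\<forall>W'\<in>\<F>. V \<inter> W \<subseteq> W' \<longrightarrow> W \<subseteq> W') \<longrightarrow> x \<in> W \<longrightarrow> sat T i x W \<phi>)"
    (is "_ \<longleftrightarrow> ?R")
proof
  assume L: "sat T i x V (Box \<phi>)"
  show ?R
  proof (intro ballI impI)
    fix W assume W: "W \<in> \<F>" "\<forall>W'\<in>\<F>. V \<inter> W \<subseteq> W' \<longrightarrow> W \<subseteq> W'" "x \<in> W"
    have oW: "openin T W" using F(1) W(1) by (simp add: finite_splitting_def)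
    then have o: "openin T (V \<inter> W)" using V(1) by blast
    \<comment> \<open>The box is instantiated at \<open>V \<inter> W\<close>, whose hull is
      \<open>W\<close>.\<close>
    have "same_above \<F> (V \<inter> W) W" using W(2) unfolding same_above_def by blast
    moreover have "sat T i x (V \<inter> W) \<phi>" using L o V(2) W(3) by simp
    ultimately show "sat T i x W \<phi>"
      using determinesD[OF det o oW] V(2) W(3) by blast
  qed
next
  assume R: ?R
  have "sat T i x V' \<phi>" if V': "openin T V'" "V' \<subseteq> V" "x \<in> V'" for V'
  proof -
    obtain W where W: "W \<in> \<F>" "openin T W" "V' \<subseteq> W" "same_above \<F> V' W"
      using same_above_hullE[OF F V'(1)] .
    \<comment> \<open>\<open>V \<inter> W\<close> lies between \<open>V'\<close> and its hull
      \<open>W\<close>, so it has the same hull.\<close>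
    have "\<forall>W'\<in>\<F>. V \<inter> W \<subseteq> W' \<longrightarrow> W \<subseteq> W'"
      using W(3,4) V'(2) unfolding same_above_def by (meson Int_greatest subset_trans)
    then have "sat T i x W \<phi>" using R W(1,3) V'(3) by blast
    then show ?thesis using determinesD[OF det V'(1) W(2,4)] V'(3) W(3) by blast
  qed
  then show "sat T i x V (Box \<phi>)" by simp
qed

section \<open>The splittings, by recursion on formulas\<close>

primrec splitting ::
    "'a topology \<Rightarrow> ('p \<Rightarrow> 'a set) \<Rightarrow> 'p form \<Rightarrow> 'a set set" where
  "splitting T i (Atom p) = {topspace T}"
| "splitting T i (Conj \<phi> \<psi>) = inter_closure (splitting T i \<phi> \<union> splitting T i \<psi>)"
| "splitting T i (Neg \<phi>) = splitting T i \<phi>"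
| "splitting T i (Box \<phi>) = inter_closure (splitting T i \<phi> \<union>
     (\<lambda>(W, W'). open_imp T W W') ` (splitting T i \<phi> \<times> splitting T i \<phi>))"
| "splitting T i (Know \<phi>) = inter_closure (splitting T i \<phi> \<union>
     (\<lambda>W. T interior_of (truth_set T i \<phi> W)) ` splitting T i \<phi>)"

lemma self_in_subformulas: "\<phi> \<in> subformulas \<phi>"
  by (cases \<phi>) auto

lemma splitting_subformula_subset:
  "\<phi> \<in> subformulas \<psi> \<Longrightarrow> splitting T i \<phi> \<subseteq> splitting T i \<psi>"
proof (induction \<psi>)
  case (Conj \<psi>1 \<psi>2)
  then show ?case
    using inter_closure_superset[of "splitting T i \<psi>1 \<union> splitting T i \<psi>2"] by auto
next
  case (Box \<psi>)
  then show ?case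
    using inter_closure_superset[of "splitting T i \<psi> \<union>
      (\<lambda>(W, W'). open_imp T W W') ` (splitting T i \<psi> \<times> splitting T i \<psi>)"] by auto
next
  case (Know \<psi>)
  then show ?case
    using inter_closure_superset[of "splitting T i \<psi> \<union>
      (\<lambda>W. T interior_of (truth_set T i \<psi> W)) ` splitting T i \<psi>"] by auto
qed auto

lemma splitting_finite: "finite (splitting T i \<phi>)"
  by (induction \<phi>) (simp_all add: finite_inter_closure)

lemma Int_in_splitting:
  "U \<in> splitting T i \<phi> \<Longrightarrow> V \<in> splitting T i \<phi> \<Longrightarrow> U \<inter> V \<in> splitting T i \<phi>"
  by (induction \<phi>) (simp_all add: Int_in_inter_closure)

lemma topspace_in_splitting: "topspace T \<in> splitting T i \<phi>"
  by (induction \<phi>) (simp_all add: subsetD[OF inter_closure_superset])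

lemma openin_splitting:
  assumes "U \<in> splitting T i \<phi>"
  shows "openin T U"
proof -
  have "splitting T i \<phi> \<subseteq> Collect (openin T)"
  proof (induction \<phi>)
    case (Conj \<phi> \<psi>)
    then show ?case
      unfolding splitting.simps by (intro inter_closure_least) (auto simp: splitting_finite)
  next
    case (Box \<phi>)
    then show ?case
      unfolding splitting.simps
      by (intro inter_closure_least) (auto simp: splitting_finite open_imp_def)
  next
    case (Know \<phi>)
    then show ?case
      unfolding splitting.simps by (intro inter_closure_least) (auto simp: splitting_finite)
  qed auto
  then show ?thesis using assms by blast
qed

lemma finite_splitting_splitting: "finite_splitting T (splitting T i \<phi>)"
  unfolding finite_splitting_def
  using splitting_finite Int_in_splitting openin_splitting by blast

text \<open>Negation needs no new opens, since determination treats truth and falsity alike. The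
  opens added for \<open>Box\<close> ignore truth values: in \<open>sat_Box_iff\<close> the open
  \<open>V\<close> enters only through the inclusions \<open>V \<inter> W \<subseteq> W'\<close>,
  and the values at \<open>(x, W)\<close> are the same for all \<open>V\<close>.\<close>

lemma determines_splitting: "determines T i (splitting T i \<phi>) \<phi>"
proof (induction \<phi>)
  case (Atom p)
  then show ?case by (simp add: determines_def)
next
  case (Conj \<phi> \<psi>)
  have "\<phi> \<in> subformulas (Conj \<phi> \<psi>)" "\<psi> \<in> subformulas (Conj \<phi> \<psi>)"
    by (simp_all add: self_in_subformulas)
  then have "determines T i (splitting T i (Conj \<phi> \<psi>)) \<phi>"
    "determines T i (splitting T i (Conj \<phi> \<psi>)) \<psi>"
    using Conj determines_mono splitting_subformula_subset by blast+
  then show ?case unfolding determines_def sat.simps by blast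
next
  case (Neg \<phi>)
  then show ?case by (simp add: determines_def)
next
  case (Box \<phi>)
  let ?F = "splitting T i \<phi>" and ?G = "splitting T i (Box \<phi>)"
  have imp: "open_imp T W W' \<in> ?G" if "W \<in> ?F" "W' \<in> ?F" for W W'
    using that by (auto intro!: subsetD[OF inter_closure_superset])
  show ?case
    unfolding determines_def
  proof (intro allI impI, elim conjE)
    fix V V' x
    assume V: "openin T V" "openin T V'" "same_above ?G V V'" "x \<in> V" "x \<in> V'"
    have "V \<inter> W \<subseteq> W' \<longleftrightarrow> V' \<inter> W \<subseteq> W'" if "W \<in> ?F" "W' \<in> ?F" for W W'
      using imp[OF that] V(3) subset_open_imp_iff[OF V(1)] subset_open_imp_iff[OF V(2)]
      unfolding same_above_def by metis
    then show "sat T i x V (Box \<phi>) = sat T i x V' (Box \<phi>)"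
      using sat_Box_iff[OF finite_splitting_splitting topspace_in_splitting Box] V(1,2,4,5)
      by (smt (verit))
  qed
next
  case (Know \<phi>)
  let ?F = "splitting T i \<phi>" and ?G = "splitting T i (Know \<phi>)"
  have int: "T interior_of (truth_set T i \<phi> W) \<in> ?G" if "W \<in> ?F" for W
    using that by (auto intro!: subsetD[OF inter_closure_superset])
  have FG: "?F \<subseteq> ?G"
    by (rule splitting_subformula_subset) (simp add: self_in_subformulas)
  show ?case
    unfolding determines_def
  proof (intro allI impI, elim conjE)
    fix V V' x
    assume V: "openin T V" "openin T V'" "same_above ?G V V'"
    obtain W where W: "W \<in> ?F" "openin T W" "V \<subseteq> W" "same_above ?F V W"
      using same_above_hullE[OF finite_splitting_splitting topspace_in_splitting V(1)] .
    \<comment> \<open>Since \<open>?G\<close> extends \<open>?F\<close>, the hull \<open>W\<close>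
      of \<open>V\<close> also serves for \<open>V'\<close>, and both truth values reduce to
      inclusion in one and the same member of \<open>?G\<close>.\<close>
    have "same_above ?F V' V"
      using same_above_sym[OF same_above_antimono[OF FG V(3)]] .
    then have W': "V' \<subseteq> W" "same_above ?F V' W"
      using W same_above_trans by (auto simp: same_above_def)
    show "sat T i x V (Know \<phi>) = sat T i x V' (Know \<phi>)"
      using sat_Know_iff[OF Know V(1) W(2-4)] sat_Know_iff[OF Know V(2) W(2) W']
        int[OF W(1)] V(3) unfolding same_above_def by blast
  qed
qed

section \<open>Membership in the generated family\<close>

locale valuation =
  fixes T :: "'a topology" and i :: "'p \<Rightarrow> 'a set"
  assumes valuation_subset: "i p \<subseteq> topspace T"
begin

lemma generated_family_subset: "S \<in> generated_family T i \<Longrightarrow> S \<subseteq> topspace T"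
  by (induction rule: generated_family.induct)
    (auto dest: subsetD[OF valuation_subset] subsetD[OF interior_of_subset_topspace])

lemma generated_family_empty: "{} \<in> generated_family T i"
proof -
  \<comment> \<open>Any atom would do; \<open>undefined\<close> merely names one.\<close>
  have "i undefined \<inter> (topspace T - i undefined) \<in> generated_family T i"
    by (intro generated_family.intros)
  then show ?thesis by simp
qed

lemma generated_family_topspace: "topspace T \<in> generated_family T i"
  using generated_family.compl[OF generated_family_empty] by simp

lemma generated_family_Diff:
  assumes "S \<in> generated_family T i" "S' \<in> generated_family T i"
  shows "S - S' \<in> generated_family T i"
proof -
  have "S - S' = S \<inter> (topspace T - S')"
    using generated_family_subset[OF assms(1)] by blast
  then show ?thesis using assms generated_family.intros by metis
qed

text \<open>The factor \<open>S\<close> covers empty \<open>I\<close>, where the bare intersection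
  would be \<open>UNIV\<close>.\<close>

lemma generated_family_INT:
  assumes "finite I" "S \<in> generated_family T i" "\<And>k. k \<in> I \<Longrightarrow> f k \<in> generated_family T i"
  shows "S \<inter> (\<Inter>k\<in>I. f k) \<in> generated_family T i"
  using assms(1,3)
proof (induction rule: finite_induct)
  case (insert k I)
  have "S \<inter> (\<Inter>k\<in>insert k I. f k) = f k \<inter> (S \<inter> (\<Inter>k\<in>I. f k))" by blast
  then show ?case using insert generated_family.inter by (metis insertCI)
qed (use assms(2) in simp)

text \<open>The two claims are proved together because the splitting for \<open>Know\<close>
  contains interiors of truth sets. The second ranges over all generated opens \<open>U\<close>, as
  a member of the splitting of a compound formula need not belong to that of its parts.\<close>

lemma splitting_subset_and_truth_set_in_generated_family:
  "splitting T i \<phi> \<subseteq> generated_family T i \<and>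
   (\<forall>U. openin T U \<and> U \<in> generated_family T i \<longrightarrow> truth_set T i \<phi> U \<in> generated_family T i)"
proof (induction \<phi>)
  case (Atom p)
  have "truth_set T i (Atom p) U = U \<inter> i p" for U by (auto simp: truth_set_def)
  then show ?case
    by (auto simp: generated_family_topspace intro: generated_family.intros)
next
  case (Conj \<phi> \<psi>)
  have "truth_set T i (Conj \<phi> \<psi>) U = truth_set T i \<phi> U \<inter> truth_set T i \<psi> U" for U
    by (auto simp: truth_set_def)
  moreover have "splitting T i (Conj \<phi> \<psi>) \<subseteq> generated_family T i"
    unfolding splitting.simps
    using Conj by (intro inter_closure_least) (auto simp: splitting_finite generated_family.inter)
  ultimately show ?case using Conj generated_family.inter by metis
next
  case (Neg \<phi>)
  have "truth_set T i (Neg \<phi>) U = U - truth_set T i \<phi> U" for U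
    by (auto simp: truth_set_def)
  then show ?case using Neg generated_family_Diff by simp
next
  case (Box \<phi>)
  let ?F = "splitting T i \<phi>"
  have "splitting T i (Box \<phi>) \<subseteq> generated_family T i"
    unfolding splitting.simps using Box
    by (intro inter_closure_least)
      (auto simp: splitting_finite open_imp_def
        intro!: generated_family.interior generated_family.compl generated_family.inter
          generated_family_Diff)
  moreover have "truth_set T i (Box \<phi>) U \<in> generated_family T i"
    if U: "openin T U" "U \<in> generated_family T i" for U
  proof -
    \<comment> \<open>\<open>D\<close> collects the \<open>W\<close> that are the hull of
      \<open>U \<inter> W\<close>. It is finite, so the condition of \<open>sat_Box_iff\<close>
      becomes a finite intersection.\<close>
    define D where "D = {W \<in> ?F. \<forall>W'\<in>?F. U \<inter> W \<subseteq> W' \<longrightarrow> W \<subseteq> W'}"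
    have "truth_set T i (Box \<phi>) U = {x \<in> U. \<forall>W\<in>D. x \<in> W \<longrightarrow> sat T i x W \<phi>}"
      unfolding truth_set_def D_def
      by (rule Collect_cong, rule conj_cong[OF refl], subst
          sat_Box_iff[OF finite_splitting_splitting topspace_in_splitting
            determines_splitting U(1)]) auto
    also have "\<dots> = U \<inter> (\<Inter>W\<in>D. topspace T - (W - truth_set T i \<phi> W))"
      using openin_subset[OF U(1)] by (auto simp: truth_set_def)
    also have "\<dots> \<in> generated_family T i"
    proof (rule generated_family_INT[OF _ U(2)])
      show "finite D" by (simp add: D_def splitting_finite)
    next
      fix W assume "W \<in> D"
      then have "W \<in> ?F" by (simp add: D_def)
      then have "W \<in> generated_family T i" "truth_set T i \<phi> W \<in> generated_family T i"
        using Box openin_splitting by blast+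
      then show "topspace T - (W - truth_set T i \<phi> W) \<in> generated_family T i"
        by (intro generated_family.compl generated_family_Diff)
    qed
    finally show ?thesis .
  qed
  ultimately show ?case by blast
next
  case (Know \<phi>)
  have "splitting T i (Know \<phi>) \<subseteq> generated_family T i"
    unfolding splitting.simps using Know
    by (intro inter_closure_least)
      (auto simp: splitting_finite dest: openin_splitting
        intro!: generated_family.interior generated_family.inter)
  \<comment> \<open>The truth of \<open>Know \<phi>\<close> at \<open>(x, U)\<close> does not depend
    on \<open>x\<close>.\<close>
  moreover have "truth_set T i (Know \<phi>) U = U \<or> truth_set T i (Know \<phi>) U = {}" for U
    by (auto simp: truth_set_def)
  ultimately show ?case using generated_family_empty by metis
qed

lemma splitting_subset_generated_opens: "splitting T i \<phi> \<subseteq> generated_opens T i"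
proof
  fix U assume U: "U \<in> splitting T i \<phi>"
  then have "U \<in> generated_family T i"
    using splitting_subset_and_truth_set_in_generated_family by blast
  moreover have "U = T interior_of U"
    using openin_splitting[OF U] by (simp add: interior_of_openin)
  ultimately show "U \<in> generated_opens T i"
    unfolding generated_opens_def by blast
qed

end

theorem mainTheorem2:
  fixes T :: "'a topology" and i :: "'p::countable \<Rightarrow> 'a set" and tt ff :: 'p
  assumes "topological_model tt ff T i"
  shows "\<exists>\<F> :: 'p form \<Rightarrow> 'a set set.
    (\<forall>\<psi>. finite_stable_splitting T i \<psi> (\<F> \<psi>)) \<and>
    (\<forall>\<psi>. \<F> \<psi> \<subseteq> generated_opens T i \<and> topspace T \<in> \<F> \<psi>) \<and>
    (\<forall>\<psi>. \<forall>U\<in>\<F> \<psi>. {x \<in> U. sat T i x U \<psi>} \<in> generated_family T i) \<and>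
    (\<forall>\<phi> \<psi>. \<phi> \<in> subformulas \<psi> \<longrightarrow>
        \<F> \<phi> \<subseteq> \<F> \<psi> \<and> finite_stable_splitting T i \<phi> (\<F> \<psi>))"
proof -
  interpret valuation T i
    using assms by unfold_locales (simp add: topological_model_def)
  \<comment> \<open>Stability for a subformula is inherited: \<open>determines\<close> passes from
    its own splitting to the larger one.\<close>
  have "finite_stable_splitting T i \<phi> (splitting T i \<psi>)" if "\<phi> \<in> subformulas \<psi>" for \<phi> \<psi>
    by (rule finite_stable_splitting_if_determines[OF finite_splitting_splitting
          determines_mono[OF determines_splitting splitting_subformula_subset[OF that]]])
  moreover have "finite_stable_splitting T i \<psi> (splitting T i \<psi>)" for \<psi>
    by (rule finite_stable_splitting_if_determines[OF finite_splitting_splitting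
          determines_splitting])
  moreover have "{x \<in> U. sat T i x U \<psi>} \<in> generated_family T i" if "U \<in> splitting T i \<psi>" for U \<psi>
    using splitting_subset_and_truth_set_in_generated_family[of \<psi>] that openin_splitting[OF that]
    unfolding truth_set_def by blast
  ultimately show ?thesis
    by (intro exI[of _ "splitting T i"])
      (simp add: splitting_subset_generated_opens topspace_in_splitting
        splitting_subformula_subset)
qed

end
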